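(* For every integer $k\geq 4$, $$f(2k-1,k-1,k)=k^2-1.$$ The extremal graphs, i.e. the $k$-connected graphs of order $2k-1$ and independence number $k-1$ having exactly $f(2k-1,k-1,k)$ edges, are precisely (up to isomorphism) the graphs $\overline{K}_{k-1}\vee T$, where $T$ is a tree of order $k$. In particular, the following assertion (the Bougard--Joret conjecture) is false: for all integers $n,\alpha,k$ with $n\geq 2\alpha$, $n\geq\alpha+k$, $\alpha\geq 2$, $k\geq 3$, $$f(n,\alpha,k)=\begin{cases}\left\lceil \dfrac{nk}{2}\right\rceil,&n\leq k\alpha,\\[6pt] t(n,\alpha)+\left\lceil\dfrac{k\alpha}{2}\right\rceil,&n>k\alpha.\end{cases}$$
   Context: All graphs are finite, simple, and undirected. A graph is $k$-connected if it has more than $k$ vertices and deleting any set of fewer than $k$ vertices leaves a connected graph. The independence number of a graph is the maximum cardinality of a set of pairwise nonadjacent vertices. For integers $n,\alpha,k$ for which the class of $k$-connected graphs of order $n$ and independence number (exactly) $\alpha$ is nonempty, $f(n,\alpha,k)$ denotes the minimum number of edges of a graph in this class. $\overline{K}_s$ is the edgeless graph of order $s$. The join $G\vee H$ is obtained from disjoint copies of $G$ and $H$ by adding every edge with one endpoint in each copy. If $n=q\alpha+r$ with $0\leq r<\alpha$, then $t(n,\alpha)=r\binom{q+1}{2}+(\alpha-r)\binom{q}{2}$, the number of edges of the disjoint union of $\alpha$ cliques of total order $n$ whose orders differ by at most one. *)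

theory Defs
  imports Complex_Main
begin

record 'a sgraph =
  verts :: "'a set"
  edges :: "'a set set"

definition fin_graph :: "'a sgraph \<Rightarrow> bool" where
  "fin_graph G \<longleftrightarrow> finite (verts G) \<and> (\<forall>e\<in>edges G. e \<subseteq> verts G \<and> card e = 2)"

definition adj :: "'a sgraph \<Rightarrow> 'a \<Rightarrow> 'a \<Rightarrow> bool" where
  "adj G u v \<longleftrightarrow> {u, v} \<in> edges G"

definition delete_verts :: "'a sgraph \<Rightarrow> 'a set \<Rightarrow> 'a sgraph" where
  "delete_verts G S = \<lparr>verts = verts G - S, edges = {e \<in> edges G. e \<inter> S = {}}\<rparr>"

definition graph_connected :: "'a sgraph \<Rightarrow> bool" where
  "graph_connected G \<longleftrightarrow>
     verts G \<noteq> {} \<and> (\<forall>u\<in>verts G. \<forall>v\<in>verts G. (adj G)\<^sup>*\<^sup>* u v)"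

definition k_connected :: "nat \<Rightarrow> 'a sgraph \<Rightarrow> bool" where
  "k_connected k G \<longleftrightarrow>
     card (verts G) > k \<and>
     (\<forall>S. S \<subseteq> verts G \<and> card S < k \<longrightarrow> graph_connected (delete_verts G S))"

definition independent_set :: "'a sgraph \<Rightarrow> 'a set \<Rightarrow> bool" where
  "independent_set G S \<longleftrightarrow>
     S \<subseteq> verts G \<and> (\<forall>u\<in>S. \<forall>v\<in>S. u \<noteq> v \<longrightarrow> \<not> adj G u v)"

definition independence_number :: "'a sgraph \<Rightarrow> nat" where
  "independence_number G = Max {card S |S. independent_set G S}"

definition graph_class :: "nat \<Rightarrow> nat \<Rightarrow> nat \<Rightarrow> 'a sgraph set" where
  "graph_class n \<alpha> k =
     {G. fin_graph G \<and> card (verts G) = n \<and> independence_number G = \<alpha> \<and> k_connected k G}"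

text \<open>
  Every finite graph is isomorphic to one with vertices in \<^typ>\<open>nat\<close>, so minimising over
  these loses nothing. On \<^typ>\<open>nat\<close> the infimum of a nonempty set is its minimum, and the
  infimum of the empty set is 0; hence a positive value of \<open>min_edges n \<alpha> k\<close> entails that
  the class is nonempty.
\<close>

definition min_edges :: "nat \<Rightarrow> nat \<Rightarrow> nat \<Rightarrow> nat" where
  "min_edges n \<alpha> k = Inf {card (edges G) |G :: nat sgraph. G \<in> graph_class n \<alpha> k}"

definition edgeless :: "nat \<Rightarrow> nat sgraph" where
  "edgeless s = \<lparr>verts = {..<s}, edges = {}\<rparr>"

definition graph_join :: "'a sgraph \<Rightarrow> 'b sgraph \<Rightarrow> ('a + 'b) sgraph" where
  "graph_join G H =
     \<lparr>verts = verts G <+> verts H,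
      edges = (image Inl) ` edges G \<union> (image Inr) ` edges H
              \<union> {{Inl u, Inr v} |u v. u \<in> verts G \<and> v \<in> verts H}\<rparr>"

definition graph_iso :: "'a sgraph \<Rightarrow> 'b sgraph \<Rightarrow> bool" where
  "graph_iso G H \<longleftrightarrow>
     (\<exists>f. bij_betw f (verts G) (verts H) \<and>
          (\<forall>u\<in>verts G. \<forall>v\<in>verts G. adj G u v \<longleftrightarrow> adj H (f u) (f v)))"

text \<open>A cycle is given by the list of its vertices, without repeating the first one at the end.\<close>

definition is_cycle :: "'a sgraph \<Rightarrow> 'a list \<Rightarrow> bool" where
  "is_cycle G xs \<longleftrightarrow>
     length xs \<ge> 3 \<and> distinct xs \<and>
     (\<forall>i<length xs. adj G (xs ! i) (xs ! (Suc i mod length xs)))"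

definition is_tree :: "'a sgraph \<Rightarrow> bool" where
  "is_tree G \<longleftrightarrow> fin_graph G \<and> graph_connected G \<and> (\<nexists>xs. is_cycle G xs)"

definition turan_edges :: "nat \<Rightarrow> nat \<Rightarrow> nat" where
  "turan_edges n \<alpha> =
     (let q = n div \<alpha>; r = n mod \<alpha>
      in r * ((q + 1) choose 2) + (\<alpha> - r) * (q choose 2))"

definition bougard_joret_conjecture :: bool where
  "bougard_joret_conjecture \<longleftrightarrow>
     (\<forall>n \<alpha> k :: nat. n \<ge> 2 * \<alpha> \<and> n \<ge> \<alpha> + k \<and> \<alpha> \<ge> 2 \<and> k \<ge> 3 \<longrightarrow>
        int (min_edges n \<alpha> k) =
          (if n \<le> k * \<alpha> then \<lceil>real (n * k) / 2\<rceil>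
           else int (turan_edges n \<alpha>) + \<lceil>real (k * \<alpha>) / 2\<rceil>))"

end

theory Submission
  imports Defs
begin

text \<open>
  Connectivity \<open>k\<close> forces minimum degree at least \<open>k\<close>. A maximum independent set \<open>I\<close> of a graph
  in the class has \<open>k - 1\<close> vertices and leaves exactly \<open>k\<close> others, so every vertex of \<open>I\<close> is
  adjacent to all of them, and deleting the \<open>k - 1\<close> vertices of \<open>I\<close> leaves a connected graph
  of order \<open>k\<close>. This graph has at least \<open>k - 1\<close> edges, with equality precisely for trees, which
  gives the minimum \<open>k * (k - 1) + (k - 1)\<close>. For \<open>k = 4\<close> the minimum is 15, while the
  conjecture predicts 14.
\<close>

section \<open>Adjacency, edges and vertex deletion\<close>

lemma adj_sym: "adj G u v \<longleftrightarrow> adj G v u"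
  by (simp add: adj_def insert_commute)

lemma adj_reach_sym: "(adj G)\<^sup>*\<^sup>* u v \<Longrightarrow> (adj G)\<^sup>*\<^sup>* v u"
  using symp_rtranclp[of "adj G"] by (simp add: symp_def adj_sym)

lemma adj_verts:
  assumes "fin_graph G" "adj G u v"
  shows "u \<in> verts G" "v \<in> verts G" "u \<noteq> v"
  using assms unfolding fin_graph_def adj_def by (force simp: card_insert_if)+

lemma edge_adj:
  assumes "fin_graph G" "e \<in> edges G"
  obtains u v where "e = {u, v}" "adj G u v"
  using assms unfolding fin_graph_def adj_def by (metis card_2_iff)

text \<open>By symmetry of adjacency, two vertices reachable from a common root \<open>a\<close>
  reach each other through it.\<close>

lemma graph_connectedI:
  assumes "verts G \<noteq> {}" "\<And>x. x \<in> verts G \<Longrightarrow> (adj G)\<^sup>*\<^sup>* a x"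
  shows "graph_connected G"
  unfolding graph_connected_def
proof (intro conjI ballI assms(1))
  fix u v assume "u \<in> verts G" "v \<in> verts G"
  then show "(adj G)\<^sup>*\<^sup>* u v"
    using rtranclp_trans[OF adj_reach_sym] assms(2) by metis
qed

lemma finite_edges:
  assumes "fin_graph G"
  shows "finite (edges G)"
  by (rule finite_subset[of _ "Pow (verts G)"]) (use assms in \<open>auto simp: fin_graph_def\<close>)

lemma fin_graph_delete_verts: "fin_graph G \<Longrightarrow> fin_graph (delete_verts G S)"
  unfolding fin_graph_def delete_verts_def by auto

lemma verts_delete_verts [simp]: "verts (delete_verts G S) = verts G - S"
  by (simp add: delete_verts_def)

lemma adj_delete_verts [simp]:
  "adj (delete_verts G S) u v \<longleftrightarrow> adj G u v \<and> u \<notin> S \<and> v \<notin> S"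
  by (auto simp: delete_verts_def adj_def)

section \<open>Trees\<close>

text \<open>A walk from inside \<open>W\<close> to a vertex outside must cross the boundary at some
  step; the induction follows the walk until it first lies outside.\<close>

lemma connected_leaving_edge:
  assumes "graph_connected G" "W \<subset> verts G" "W \<noteq> {}"
  obtains u v where "u \<in> W" "v \<notin> W" "adj G u v"
proof -
  obtain a b where ab: "a \<in> W" "b \<in> verts G" "b \<notin> W" "a \<in> verts G"
    using assms by blast
  then have "(adj G)\<^sup>*\<^sup>* a b"
    using assms by (simp add: graph_connected_def)
  then have "b \<notin> W \<longrightarrow> (\<exists>u\<in>W. \<exists>v. v \<notin> W \<and> adj G u v)"
    by (induction rule: rtranclp_induct) (use ab in auto)
  with ab that show thesis by blast
qed

text \<open>Grows a tree one leaf at a time: each new vertex is attached by a single edge leaving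
  the current vertex set. Only edges are counted, so acyclicity never has to be maintained.\<close>

lemma connected_subgraph_of_card:
  assumes G: "fin_graph G" "graph_connected G" and "Suc m \<le> card (verts G)"
  shows "\<exists>H. fin_graph H \<and> graph_connected H \<and> verts H \<subseteq> verts G \<and> edges H \<subseteq> edges G \<and>
           card (verts H) = Suc m \<and> card (edges H) = m"
  using assms(3)
proof (induction m)
  case 0
  from G obtain a where "a \<in> verts G" by (auto simp: graph_connected_def)
  then show ?case
    by (intro exI[of _ "\<lparr>verts = {a}, edges = {}\<rparr>"])
       (auto simp: graph_connected_def fin_graph_def)
next
  case (Suc m)
  then obtain H :: "'a sgraph" where H: "fin_graph H" "graph_connected H" "verts H \<subseteq> verts G"
    "edges H \<subseteq> edges G" "card (verts H) = Suc m" "card (edges H) = m"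
    using Suc_leD by blast
  have fin: "finite (verts H)" "finite (edges H)"
    using H finite_edges by (auto simp: fin_graph_def)
  have "verts H \<subset> verts G" "verts H \<noteq> {}" using H Suc.prems by auto
  then obtain u v where uv: "u \<in> verts H" "v \<notin> verts H" "adj G u v"
    using connected_leaving_edge[OF G(2)] by metis
  define K :: "'a sgraph" where
    "K = \<lparr>verts = insert v (verts H), edges = insert {u, v} (edges H)\<rparr>"
  have "v \<in> verts G" "u \<noteq> v" using adj_verts[OF G(1) uv(3)] by auto
  then have "fin_graph K" using H uv by (auto simp: fin_graph_def K_def)
  moreover have "{u, v} \<notin> edges H" using H(1) uv by (auto simp: fin_graph_def)
  moreover have "graph_connected K"
  proof -
    have sub: "adj H x y \<Longrightarrow> adj K x y" for x y by (auto simp: adj_def K_def)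
    have reach: "(adj K)\<^sup>*\<^sup>* u x" if "x \<in> verts K" for x
    proof (cases "x = v")
      case True
      then show ?thesis by (auto simp: adj_def K_def)
    next
      case False
      with that have "x \<in> verts H" by (auto simp: K_def)
      then have "(adj H)\<^sup>*\<^sup>* u x" using H(2) uv by (auto simp: graph_connected_def)
      then show ?thesis using sub by (rule mono_rtranclp[rule_format, rotated]) auto
    qed
    have "verts K \<noteq> {}" by (simp add: K_def)
    then show ?thesis using reach by (rule graph_connectedI)
  qed
  ultimately show ?case
    using H uv fin \<open>v \<in> verts G\<close>
    by (intro exI[of _ K]) (auto simp: K_def adj_def)
qed

text \<open>The growth is run until every vertex is absorbed. The result is a spanning tree,
  described by its edge count.\<close>

lemma connected_spanning_subgraph:
  assumes "fin_graph G" "graph_connected G"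
  obtains H where "fin_graph H" "graph_connected H" "verts H = verts G" "edges H \<subseteq> edges G"
    "Suc (card (edges H)) = card (verts G)"
proof -
  have fin: "finite (verts G)" "verts G \<noteq> {}"
    using assms by (auto simp: fin_graph_def graph_connected_def)
  then obtain m where m: "card (verts G) = Suc m"
    by (metis card_gt_0_iff gr0_implies_Suc)
  then obtain H where "fin_graph H" "graph_connected H" "verts H \<subseteq> verts G" "edges H \<subseteq> edges G"
     "card (verts H) = Suc m" "card (edges H) = m"
    using connected_subgraph_of_card[OF assms] by (metis order_refl)
  then show thesis using that m card_subset_eq fin by metis
qed

lemma connected_card_edges:
  assumes "fin_graph G" "graph_connected G"
  shows "card (verts G) \<le> Suc (card (edges G))"
  by (metis assms connected_spanning_subgraph Suc_le_mono card_mono finite_edges)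

text \<open>The path is extended step by step; when the next vertex already occurs on it, the path
  is cut back to that occurrence, which keeps the vertices distinct.\<close>

lemma simple_path_of_rtranclp:
  assumes "R\<^sup>*\<^sup>* u v"
  obtains xs where "xs \<noteq> []" "distinct xs" "hd xs = u" "last xs = v" "successively R xs"
proof -
  from assms
  have "\<exists>xs. xs \<noteq> [] \<and> distinct xs \<and> hd xs = u \<and> last xs = v \<and> successively R xs"
  proof (induction rule: rtranclp_induct)
    case base
    show ?case by (intro exI[of _ "[u]"]) auto
  next
    case (step y z)
    then obtain xs where xs: "xs \<noteq> []" "distinct xs" "hd xs = u" "last xs = y" "successively R xs"
      by auto
    show ?case
    proof (cases "z \<in> set xs")
      case True
      then obtain as bs where "xs = as @ z # bs" by (auto simp: in_set_conv_decomp)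
      with xs show ?thesis
        by (intro exI[of _ "as @ [z]"]) (auto simp: successively_append_iff hd_append)
    next
      case False
      with xs step(2) show ?thesis
        by (intro exI[of _ "xs @ [z]"]) (auto simp: successively_append_iff)
    qed
  qed
  with that show thesis by blast
qed

text \<open>The rest of the cycle is a detour between the ends of the deleted closing edge, so every
  walk can be rerouted.\<close>

lemma connected_delete_cycle_edge:
  assumes con: "graph_connected G" and cyc: "is_cycle G xs"
  shows "graph_connected \<lparr>verts = verts G, edges = edges G - {{hd xs, last xs}}\<rparr>"
    (is "graph_connected ?H")
proof -
  have len: "length xs \<ge> 3" and dist: "distinct xs"
    and step: "\<And>i. i < length xs \<Longrightarrow> adj G (xs ! i) (xs ! (Suc i mod length xs))"
    using cyc by (auto simp: is_cycle_def)
  have ends: "hd xs = xs ! 0" "last xs = xs ! (length xs - 1)"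
    using len by (auto simp: hd_conv_nth last_conv_nth simp flip: length_greater_0_conv)
  \<comment> \<open>Going up the indices from 0 uses every edge of the cycle except the closing
    one.\<close>
  have *: "(adj ?H)\<^sup>*\<^sup>* (xs ! 0) (xs ! i)" if "i < length xs" for i
    using that
  proof (induction i)
    case (Suc i)
    have nth_eq: "xs ! a = xs ! b \<longleftrightarrow> a = b" if "a < length xs" "b < length xs" for a b
      using nth_eq_iff_index_eq[OF dist] that by blast
    \<comment> \<open>The two pairs could coincide only on a cycle of length 2, which
      \<open>length xs \<ge> 3\<close> excludes.\<close>
    have "{xs ! i, xs ! Suc i} \<noteq> {xs ! 0, xs ! (length xs - 1)}"
      using len Suc.prems nth_eq[of i 0] nth_eq[of "Suc i" 0]
        nth_eq[of "Suc i" "length xs - 1"]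
      unfolding doubleton_eq_iff by linarith
    then have "adj ?H (xs ! i) (xs ! Suc i)"
      using step[of i] Suc.prems ends by (auto simp: adj_def)
    with Suc show ?case by auto
  qed auto
  have cl: "(adj ?H)\<^sup>*\<^sup>* (hd xs) (last xs)" using *[of "length xs - 1"] len ends by simp
  have edge: "(adj ?H)\<^sup>*\<^sup>* x y" if "adj G x y" for x y
  proof (cases "{x, y} = {hd xs, last xs}")
    case True
    then show ?thesis using cl adj_reach_sym[OF cl] unfolding doubleton_eq_iff by blast
  next
    case False
    with that have "adj ?H x y" by (simp add: adj_def)
    then show ?thesis by (rule r_into_rtranclp)
  qed
  have "(adj ?H)\<^sup>*\<^sup>* x y" if "(adj G)\<^sup>*\<^sup>* x y" for x y
    using that
  proof (induction rule: rtranclp_induct)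
    case (step y z)
    then show ?case using edge rtranclp_trans by metis
  qed simp
  with con show ?thesis by (simp add: graph_connected_def)
qed

text \<open>Replaces acyclicity by an edge count, the form in which extremality appears. An edge
  outside a spanning tree closes a cycle with a path of that tree; conversely, deleting an edge of a
  cycle would leave a connected graph with too few edges.\<close>

lemma is_tree_iff_card_edges:
  assumes "fin_graph G"
  shows "is_tree G \<longleftrightarrow> graph_connected G \<and> Suc (card (edges G)) = card (verts G)"
proof (intro iffI conjI)
  assume tree: "is_tree G"
  then show con: "graph_connected G" by (simp add: is_tree_def)
  obtain H where H: "fin_graph H" "graph_connected H" "verts H = verts G" "edges H \<subseteq> edges G"
    "Suc (card (edges H)) = card (verts G)"
    using connected_spanning_subgraph[OF assms con] .
  have "edges G \<subseteq> edges H"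
  proof (rule ccontr)
    assume "\<not> edges G \<subseteq> edges H"
    then obtain u v where uv: "adj G u v" "{u, v} \<notin> edges H"
      using edge_adj[OF assms] by (metis subsetI)
    then have ne: "u \<noteq> v" "u \<in> verts G" "v \<in> verts G" using adj_verts[OF assms] by metis+
    then have "(adj H)\<^sup>*\<^sup>* u v" using H by (simp add: graph_connected_def)
    then obtain xs where xs: "xs \<noteq> []" "distinct xs" "hd xs = u" "last xs = v"
      "successively (adj H) xs"
      by (rule simple_path_of_rtranclp)
    \<comment> \<open>A path with one vertex would give \<open>u = v\<close>, and one with two
      vertices would make \<open>{u, v}\<close> an edge of \<open>H\<close>.\<close>
    have "length xs \<ge> 3"
    proof (rule ccontr)
      assume "\<not> length xs \<ge> 3"
      then consider a where "xs = [a]" | a b where "xs = [a, b]"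
        using xs(1) by (cases xs; cases "tl xs"; cases "tl (tl xs)") auto
      then show False by cases (use xs ne uv in \<open>auto simp: adj_def\<close>)
    qed
    \<comment> \<open>The edge missing from \<open>H\<close> leads from the last vertex of the path
      back to the first; all other steps are edges of \<open>H\<close>.\<close>
    moreover have "adj G (xs ! i) (xs ! (Suc i mod length xs))" if "i < length xs" for i
    proof (cases "Suc i = length xs")
      case True
      then have "xs ! i = v" "xs ! 0 = u"
        using xs by (auto simp: last_conv_nth hd_conv_nth simp flip: True)
      then show ?thesis using uv True by (simp add: adj_sym)
    next
      case False
      with that have "adj H (xs ! i) (xs ! Suc i)"
        using xs(5) by (simp add: successively_conv_nth)
      then show ?thesis using H(4) False that by (auto simp: adj_def)
    qed
    ultimately have "is_cycle G xs" using xs(2) by (simp add: is_cycle_def)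
    with tree show False by (auto simp: is_tree_def)
  qed
  with H show "Suc (card (edges G)) = card (verts G)" by auto
next
  assume *: "graph_connected G \<and> Suc (card (edges G)) = card (verts G)"
  have False if cyc: "is_cycle G xs" for xs
  proof -
    let ?H = "\<lparr>verts = verts G, edges = edges G - {{hd xs, last xs}}\<rparr>"
    have "fin_graph ?H" using assms by (auto simp: fin_graph_def)
    moreover have "graph_connected ?H"
      using connected_delete_cycle_edge[OF _ cyc] * by blast
    ultimately have "card (verts G) \<le> Suc (card (edges ?H))"
      using connected_card_edges by fastforce
    moreover have len: "length xs \<ge> 3" using cyc by (simp add: is_cycle_def)
    \<comment> \<open>At the last index the successor modulo the length is 0, so the cycle condition
      yields the closing edge.\<close>
    then have "adj G (last xs) (hd xs)"
      using cyc[unfolded is_cycle_def, THEN conjunct2, THEN conjunct2, rule_format,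
          of "length xs - 1"]
      by (auto simp: hd_conv_nth last_conv_nth simp flip: length_greater_0_conv)
    then have "{hd xs, last xs} \<in> edges G" by (simp add: adj_def insert_commute)
    then have "card (edges ?H) < card (edges G)"
      using card_Diff1_less[OF finite_edges[OF assms]] by simp
    ultimately show False using * by simp
  qed
  with * assms show "is_tree G" by (auto simp: is_tree_def)
qed

section \<open>Isomorphisms\<close>

lemma graph_iso_sym:
  assumes "graph_iso G H"
  shows "graph_iso H G"
proof -
  obtain f where f: "bij_betw f (verts G) (verts H)"
    "\<forall>u\<in>verts G. \<forall>v\<in>verts G. adj G u v \<longleftrightarrow> adj H (f u) (f v)"
    using assms by (auto simp: graph_iso_def)
  let ?g = "inv_into (verts G) f"
  have "bij_betw ?g (verts H) (verts G)" using f(1) by (rule bij_betw_inv_into)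
  moreover have "f (?g x) = x" "?g x \<in> verts G" if "x \<in> verts H" for x
    using that f(1) by (auto simp: bij_betw_def f_inv_into_f inv_into_into)
  ultimately show ?thesis using f(2) by (auto simp: graph_iso_def intro!: exI[of _ ?g])
qed

lemma graph_iso_card_verts: "graph_iso G H \<Longrightarrow> card (verts G) = card (verts H)"
  by (auto simp: graph_iso_def bij_betw_same_card)

text \<open>\<open>graph_iso\<close> speaks only of pairs of vertices. Under
  \<open>fin_graph\<close> every edge is such a pair, so taking images under the isomorphism is a
  bijection between the edge sets.\<close>

lemma graph_iso_card_edges:
  assumes "fin_graph G" "fin_graph H" "graph_iso G H"
  shows "card (edges G) = card (edges H)"
proof -
  obtain f where f: "bij_betw f (verts G) (verts H)"
    "\<And>u v. u \<in> verts G \<Longrightarrow> v \<in> verts G \<Longrightarrow> adj G u v \<longleftrightarrow> adj H (f u) (f v)"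
    using assms by (auto simp: graph_iso_def)
  have "inj_on f (verts G)" and im: "f ` verts G = verts H" using f(1) by (auto simp: bij_betw_def)
  then have "inj_on (image f) (Pow (verts G))" by (simp add: inj_on_image_Pow)
  then have "inj_on (image f) (edges G)"
    by (rule inj_on_subset) (use assms in \<open>auto simp: fin_graph_def\<close>)
  moreover have "(image f) ` edges G = edges H"
  proof (intro equalityI subsetI)
    fix e assume "e \<in> (image f) ` edges G"
    then obtain d where d: "d \<in> edges G" "e = f ` d" by auto
    then obtain u v where "d = {u, v}" "adj G u v" using edge_adj[OF assms(1)] by metis
    moreover from this have "adj H (f u) (f v)" using f(2) adj_verts[OF assms(1)] by metis
    ultimately show "e \<in> edges H" using d by (simp add: adj_def)
  next
    fix e assume "e \<in> edges H"
    then obtain x y where xy: "e = {x, y}" "adj H x y" using edge_adj[OF assms(2)] by metis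
    then have "x \<in> f ` verts G" "y \<in> f ` verts G" using im adj_verts[OF assms(2)] by metis+
    then obtain u v where uv: "u \<in> verts G" "v \<in> verts G" "x = f u" "y = f v" by blast
    then have "adj G u v" using f(2) xy by simp
    then show "e \<in> (image f) ` edges G"
      using uv xy by (auto simp: adj_def intro!: image_eqI[of _ _ "{u, v}"])
  qed
  ultimately show ?thesis using card_image by metis
qed

text \<open>\<open>fin_graph G\<close> keeps the steps of a walk inside the vertex set, where the
  isomorphism is known to preserve adjacency.\<close>

lemma graph_iso_connected:
  assumes "fin_graph G" "graph_iso G H" "graph_connected G"
  shows "graph_connected H"
proof -
  obtain f where f: "bij_betw f (verts G) (verts H)"
    "\<And>u v. u \<in> verts G \<Longrightarrow> v \<in> verts G \<Longrightarrow> adj G u v \<longleftrightarrow> adj H (f u) (f v)"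
    using assms by (auto simp: graph_iso_def)
  have "(adj H)\<^sup>*\<^sup>* (f u) (f v)" if "(adj G)\<^sup>*\<^sup>* u v" for u v
    using that
  proof (induction rule: rtranclp_induct)
    case (step y z)
    then have "adj H (f y) (f z)" using f(2) adj_verts[OF assms(1)] by metis
    with step show ?case by auto
  qed auto
  moreover have "verts H = f ` verts G" using f(1) by (simp add: bij_betw_def)
  ultimately show ?thesis using assms(3) by (simp add: graph_connected_def)
qed

lemma graph_iso_is_tree:
  assumes "fin_graph G" "fin_graph H" "graph_iso G H"
  shows "is_tree G \<longleftrightarrow> is_tree H"
  using graph_iso_card_edges[OF assms] graph_iso_card_verts[OF assms(3)]
    graph_iso_connected[OF assms(1,3)] graph_iso_connected[OF assms(2) graph_iso_sym[OF assms(3)]]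
  by (auto simp: is_tree_iff_card_edges assms)

lemma ex_iso_of_inj:
  fixes f :: "'a \<Rightarrow> 'b"
  assumes "fin_graph G" "inj_on f (verts G)"
  obtains H :: "'b sgraph" where "fin_graph H" "graph_iso G H"
proof -
  let ?H = "\<lparr>verts = f ` verts G, edges = (image f) ` edges G\<rparr>"
  have sub: "e \<subseteq> verts G" "card e = 2" if "e \<in> edges G" for e
    using assms that by (auto simp: fin_graph_def)
  have "fin_graph ?H"
    unfolding fin_graph_def
  proof (intro conjI ballI)
    show "finite (verts ?H)" using assms by (simp add: fin_graph_def)
  next
    fix e assume "e \<in> edges ?H"
    then obtain d where d: "d \<in> edges G" "e = f ` d" by auto
    then show "e \<subseteq> verts ?H" using sub by auto
    show "card e = 2" using d sub assms(2) card_image inj_on_subset by metis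
  qed
  moreover have "graph_iso G ?H"
    unfolding graph_iso_def
  proof (intro exI[of _ f] conjI ballI)
    show "bij_betw f (verts G) (verts ?H)" using assms by (simp add: bij_betw_def)
  next
    fix u v assume uv: "u \<in> verts G" "v \<in> verts G"
    have "{u, v} \<in> edges G" if "f ` {u, v} = f ` d" "d \<in> edges G" for d
      using inj_on_image_eq_iff[OF assms(2), of "{u, v}" d] that sub uv by auto
    then show "adj G u v \<longleftrightarrow> adj ?H (f u) (f v)"
      by (auto simp: adj_def image_iff intro!: bexI[of _ "{u, v}"])
  qed
  ultimately show thesis using that[of ?H] by simp
qed

text \<open>Connects graphs on arbitrary vertex types with those on \<open>nat\<close>, over which
  \<open>min_edges\<close> minimises and among which the tree \<open>T\<close> is sought.\<close>

lemma ex_iso_nat: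
  assumes "fin_graph G"
  obtains H :: "nat sgraph" where "fin_graph H" "graph_iso G H"
proof -
  obtain f :: "'a \<Rightarrow> nat" where "inj_on f (verts G)"
    using assms finite_imp_inj_to_nat_seg unfolding fin_graph_def by metis
  with assms that ex_iso_of_inj show thesis by metis
qed

section \<open>Joins with an independent set\<close>

text \<open>An intrinsic form of being a join of an edgeless graph with another graph: it names the
  edgeless side inside \<open>G\<close> and avoids the sum type of
  \<open>graph_join\<close>.\<close>

definition join_part :: "'a sgraph \<Rightarrow> 'a set \<Rightarrow> bool" where
  "join_part G I \<longleftrightarrow> independent_set G I \<and> (\<forall>u\<in>I. \<forall>v\<in>verts G - I. adj G u v)"

text \<open>Injectivity and disjointness of \<open>Inl\<close> and \<open>Inr\<close> decide to
  which of the three edge families of \<open>graph_join\<close> a given pair can belong.\<close>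

lemma adj_graph_join [simp]:
  "adj (graph_join G H) (Inl u) (Inl v) \<longleftrightarrow> adj G u v"
  "adj (graph_join G H) (Inr x) (Inr y) \<longleftrightarrow> adj H x y"
  "adj (graph_join G H) (Inl u) (Inr y) \<longleftrightarrow> u \<in> verts G \<and> y \<in> verts H"
  "adj (graph_join G H) (Inr y) (Inl u) \<longleftrightarrow> u \<in> verts G \<and> y \<in> verts H"
proof -
  have inl: "{Inl u, Inl v} = Inl ` e \<longleftrightarrow> {u, v} = e" for u v :: 'a and e
    using inj_image_eq_iff[OF inj_Inl, of "{u, v}" e] by simp
  have inr: "{Inr x, Inr y} = Inr ` e \<longleftrightarrow> {x, y} = e" for x y :: 'b and e
    using inj_image_eq_iff[OF inj_Inr, of "{x, y}" e] by simp
  have no1: "insert (Inl u) Z \<noteq> Inr ` e" for u :: 'a and Z :: "('a + 'b) set" and e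
    by (metis imageE insertI1 sum.distinct(1))
  have no2: "insert (Inr y) Z \<noteq> Inl ` e" for y :: 'b and Z :: "('a + 'b) set" and e
    by (metis imageE insertI1 sum.distinct(1))
  have no3: "{Inl u, Inr y} \<noteq> Inl ` e" for u :: 'a and y :: 'b and e
    using no2 by (metis insert_commute)
  show "adj (graph_join G H) (Inl u) (Inl v) \<longleftrightarrow> adj G u v"
    "adj (graph_join G H) (Inr x) (Inr y) \<longleftrightarrow> adj H x y"
    and *: "adj (graph_join G H) (Inl u) (Inr y) \<longleftrightarrow> u \<in> verts G \<and> y \<in> verts H"
    by (auto simp: adj_def graph_join_def image_iff inl inr no1 no2 no3 doubleton_eq_iff)
  show "adj (graph_join G H) (Inr y) (Inl u) \<longleftrightarrow> u \<in> verts G \<and> y \<in> verts H"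
    using * adj_sym by metis
qed

lemma fin_graph_join:
  assumes "fin_graph G" "fin_graph H"
  shows "fin_graph (graph_join G H)"
  using assms by (auto simp: fin_graph_def graph_join_def card_image)

lemma fin_graph_edgeless: "fin_graph (edgeless s)"
  by (simp add: fin_graph_def edgeless_def)

lemma edgeless_simps [simp]: "verts (edgeless s) = {..<s}" "\<not> adj (edgeless s) u v"
  by (simp_all add: edgeless_def adj_def)

lemma verts_graph_join [simp]: "verts (graph_join G H) = verts G <+> verts H"
  by (simp add: graph_join_def)

text \<open>From left to right, \<open>I\<close> is the preimage of the left summand. From right to
  left, any bijection of \<open>I\<close> with \<open>{..<s}\<close> can be glued to the isomorphism
  on the remaining vertices.\<close>

lemma graph_iso_join_edgeless_iff:
  assumes "fin_graph G"
  shows "graph_iso G (graph_join (edgeless s) T) \<longleftrightarrow>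
    (\<exists>I. join_part G I \<and> card I = s \<and> graph_iso (delete_verts G I) T)"
    (is "graph_iso G ?J \<longleftrightarrow> ?R")
proof
  assume "graph_iso G ?J"
  then obtain f where bij: "bij_betw f (verts G) ({..<s} <+> verts T)"
    and f: "\<And>u v. u \<in> verts G \<Longrightarrow> v \<in> verts G \<Longrightarrow> adj G u v \<longleftrightarrow> adj ?J (f u) (f v)"
    by (auto simp: graph_iso_def)
  have inj: "inj_on f (verts G)" and im: "f ` verts G = {..<s} <+> verts T"
    using bij by (auto simp: bij_betw_def)
  define I where "I = {x \<in> verts G. f x \<in> range Inl}"
  have "Inl ` {..<s} = f ` I"
  proof (intro equalityI subsetI)
    fix y assume "y \<in> f ` I"
    then obtain x where "x \<in> verts G" "y = f x" "f x \<in> range Inl" by (auto simp: I_def)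
    moreover from this have "y \<in> {..<s} <+> verts T" using im by blast
    ultimately show "y \<in> Inl ` {..<s}" by auto
  next
    fix y :: "nat + 'b" assume y: "y \<in> Inl ` {..<s}"
    then have "y \<in> f ` verts G" using im by blast
    then obtain x where "x \<in> verts G" "y = f x" by blast
    with y show "y \<in> f ` I" by (auto simp: I_def)
  qed
  moreover have "card (f ` I) = card I"
    by (rule card_image, rule inj_on_subset[OF inj]) (simp add: I_def)
  ultimately have "card I = s" by (metis card_image card_lessThan inj_Inl)
  \<comment> \<open>Vertices outside \<open>I\<close> land in the right summand, so
    \<open>projr\<close> loses no information on them.\<close>
  have out: "f x \<in> Inr ` verts T" if "x \<in> verts G - I" for x
  proof -
    have "f x \<in> {..<s} <+> verts T" using im that by blast
    with that show ?thesis by (auto simp: I_def)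
  qed
  have "join_part G I"
    unfolding join_part_def independent_set_def
  proof (intro conjI ballI impI)
    show "I \<subseteq> verts G" by (auto simp: I_def)
  next
    fix u v assume "u \<in> I" "v \<in> I"
    then show "\<not> adj G u v" using f by (auto simp: I_def)
  next
    fix u v assume uv: "u \<in> I" "v \<in> verts G - I"
    then obtain a b where "f u = Inl a" "f v = Inr b" "b \<in> verts T" using out by (fastforce simp: I_def)
    moreover have "f u \<in> {..<s} <+> verts T" using uv im by (auto simp: I_def)
    ultimately show "adj G u v" using f[of u v] uv by (auto simp: I_def)
  qed
  moreover have "graph_iso (delete_verts G I) T"
    unfolding graph_iso_def
  proof (intro exI[of _ "projr \<circ> f"] conjI ballI)
    have "(projr \<circ> f) ` (verts G - I) = verts T"
    proof (intro equalityI subsetI)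
      fix y assume "y \<in> (projr \<circ> f) ` (verts G - I)"
      then show "y \<in> verts T" using out by force
    next
      fix y assume "y \<in> verts T"
      then have "Inr y \<in> f ` verts G" using im by blast
      then obtain x where "x \<in> verts G" "f x = Inr y" by (metis imageE)
      moreover from this have "x \<notin> I" by (auto simp: I_def)
      ultimately show "y \<in> (projr \<circ> f) ` (verts G - I)" by force
    qed
    moreover have "inj_on (projr \<circ> f) (verts G - I)"
    proof (rule inj_onI)
      fix x y assume *: "x \<in> verts G - I" "y \<in> verts G - I" "(projr \<circ> f) x = (projr \<circ> f) y"
      then have "f x = f y" using out[of x] out[of y] by auto
      then show "x = y" using inj * by (auto dest: inj_onD)
    qed
    ultimately show "bij_betw (projr \<circ> f) (verts (delete_verts G I)) (verts T)"
      by (simp add: bij_betw_def)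
  next
    fix u v assume "u \<in> verts (delete_verts G I)" "v \<in> verts (delete_verts G I)"
    then show "adj (delete_verts G I) u v \<longleftrightarrow> adj T ((projr \<circ> f) u) ((projr \<circ> f) v)"
      using f[of u v] out[of u] out[of v] by auto
  qed
  ultimately show ?R using \<open>card I = s\<close> by blast
next
  assume ?R
  then obtain I h where I: "join_part G I" "card I = s"
    and h: "bij_betw h (verts G - I) (verts T)"
    "\<And>u v. u \<in> verts G - I \<Longrightarrow> v \<in> verts G - I \<Longrightarrow> adj G u v \<longleftrightarrow> adj T (h u) (h v)"
    by (auto simp: graph_iso_def)
  have sub: "I \<subseteq> verts G" using I by (simp add: join_part_def independent_set_def)
  with assms have "finite I" by (auto simp: fin_graph_def dest: finite_subset)
  with I obtain g where g: "bij_betw g I {..<s}"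
    by (metis bij_betw_iff_card card_lessThan finite_lessThan)
  let ?f = "\<lambda>x. if x \<in> I then Inl (g x) else Inr (h x)"
  have gI: "g u < s" if "u \<in> I" for u using g that by (auto simp: bij_betw_def)
  have hI: "h u \<in> verts T" if "u \<in> verts G" "u \<notin> I" for u
    using h(1) that by (auto simp: bij_betw_def)
  show "graph_iso G ?J"
    unfolding graph_iso_def
  proof (intro exI[of _ ?f] conjI ballI)
    have "inj_on ?f (verts G)"
      using g h(1) by (auto simp: inj_on_def bij_betw_def)
    moreover have "?f ` verts G = Inl ` (g ` I) \<union> Inr ` (h ` (verts G - I))"
      using sub by force
    then have "?f ` verts G = verts ?J"
      using g h(1) by (simp add: bij_betw_def Plus_def)
    ultimately show "bij_betw ?f (verts G) (verts ?J)" by (simp add: bij_betw_def)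
  next
    fix u v assume uv: "u \<in> verts G" "v \<in> verts G"
    have ind: "\<not> adj G u v" if "u \<in> I" "v \<in> I"
      using that I(1) adj_verts(3)[OF assms, of u v]
      by (auto simp: join_part_def independent_set_def)
    have full: "adj G x y" "adj G y x" if "x \<in> I" "y \<in> verts G - I" for x y
      using that I(1) adj_sym[of G x y] by (auto simp: join_part_def)
    show "adj G u v \<longleftrightarrow> adj ?J (?f u) (?f v)"
      using uv ind full h(2)[of u v] gI hI by auto
  qed
qed

text \<open>No edge lies inside \<open>I\<close>: each edge either crosses to the remaining
  vertices, where all pairs are present, or avoids \<open>I\<close>.\<close>

lemma join_part_card_edges:
  assumes G: "fin_graph G" and I: "join_part G I"
  shows "card (edges G) = card I * card (verts G - I) + card (edges (delete_verts G I))"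
proof -
  let ?cross = "(\<lambda>(u, v). {u, v}) ` (I \<times> (verts G - I))"
  have sub: "I \<subseteq> verts G" and ind: "\<And>u v. u \<in> I \<Longrightarrow> v \<in> I \<Longrightarrow> u \<noteq> v \<Longrightarrow> \<not> adj G u v"
    and full: "\<And>u v. u \<in> I \<Longrightarrow> v \<in> verts G - I \<Longrightarrow> adj G u v"
    using I by (auto simp: join_part_def independent_set_def)
  have fin: "finite I" "finite (verts G)" "finite (edges G)"
    using G sub finite_edges[OF G] finite_subset by (auto simp: fin_graph_def)
  have "edges G = ?cross \<union> edges (delete_verts G I)"
  proof (intro equalityI subsetI)
    fix e assume e: "e \<in> edges G"
    then obtain u v where uv: "e = {u, v}" "adj G u v" using edge_adj[OF G] by metis
    have mem: "u \<in> verts G" "v \<in> verts G" "u \<noteq> v" using adj_verts[OF G uv(2)] by auto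
    consider "u \<in> I" "v \<notin> I" | "v \<in> I" "u \<notin> I" | "u \<notin> I" "v \<notin> I"
      using ind uv mem by blast
    then show "e \<in> ?cross \<union> edges (delete_verts G I)"
    proof cases
      case 1
      then have "(u, v) \<in> I \<times> (verts G - I)" using mem by simp
      then show ?thesis using uv by force
    next
      case 2
      then have "(v, u) \<in> I \<times> (verts G - I)" using mem by simp
      then show ?thesis using uv by (force simp: insert_commute)
    next
      case 3
      then show ?thesis using uv e by (simp add: delete_verts_def)
    qed
  next
    fix e assume "e \<in> ?cross \<union> edges (delete_verts G I)"
    then show "e \<in> edges G" using full by (auto simp: adj_def delete_verts_def)
  qed
  moreover have "?cross \<inter> edges (delete_verts G I) = {}" by (auto simp: delete_verts_def)
  moreover have "inj_on (\<lambda>(u, v). {u, v}) (I \<times> (verts G - I))"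
    by (auto simp: inj_on_def doubleton_eq_iff)
  then have "card ?cross = card I * card (verts G - I)"
    by (simp add: card_image card_cartesian_product)
  moreover have "finite (edges (delete_verts G I))"
    using finite_edges fin_graph_delete_verts G by blast
  ultimately show ?thesis using fin by (simp add: card_Un_disjoint)
qed

section \<open>Independence number, minimum degree and the structure of the class\<close>

lemma finite_independent_cards:
  assumes "fin_graph G"
  shows "finite {card S |S. independent_set G S}" (is "finite ?C")
    and "{card S |S. independent_set G S} \<noteq> {}"
proof -
  have "?C \<subseteq> card ` Pow (verts G)" by (auto simp: independent_set_def)
  then show "finite ?C" using assms finite_subset by (fastforce simp: fin_graph_def)
  have "independent_set G {}" by (simp add: independent_set_def)
  then show "?C \<noteq> {}" by blast
qed

text \<open>Deleting a neighbourhood of fewer than \<open>k\<close> vertices would isolate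
  \<open>v\<close> from some surviving vertex.\<close>

lemma k_connected_card_neighbours:
  assumes G: "fin_graph G" "k_connected k G" and v: "v \<in> verts G"
  shows "k \<le> card {u. adj G v u}" (is "k \<le> card ?N")
proof (rule ccontr)
  assume less: "\<not> k \<le> card ?N"
  have N: "?N \<subseteq> verts G" "v \<notin> ?N" using adj_verts[OF G(1)] by blast+
  have "finite ?N" using N G by (auto simp: fin_graph_def dest: finite_subset)
  \<comment> \<open>With fewer than \<open>k\<close> neighbours, \<open>v\<close> and its neighbours
    number at most \<open>k\<close>, while the order exceeds \<open>k\<close>; so a further vertex
    \<open>w\<close> exists.\<close>
  then have "card (insert v ?N) < card (verts G)"
    using less G N by (simp add: k_connected_def)
  then have "\<not> verts G \<subseteq> insert v ?N"
    using \<open>finite ?N\<close> by (metis card_mono finite_insert not_less)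
  then obtain w where w: "w \<in> verts G" "w \<noteq> v" "w \<notin> ?N" by blast
  have "graph_connected (delete_verts G ?N)" using G N less by (simp add: k_connected_def)
  then have "(adj (delete_verts G ?N))\<^sup>*\<^sup>* v w"
    using v w N by (simp add: graph_connected_def)
  then show False using w by (auto elim: converse_rtranclpE)
qed

text \<open>Forwards, each of the \<open>k - 1\<close> vertices of a maximum independent set needs
  \<open>k\<close> neighbours and has only the \<open>k\<close> outside vertices to choose from.
  Backwards, both the independence number and the connectivity are read off from the join and the
  connected remainder.\<close>

lemma graph_class_iff_join_part:
  assumes G: "fin_graph G" and k: "k \<ge> 2"
  shows "G \<in> graph_class (2 * k - 1) (k - 1) k \<longleftrightarrow>
    (\<exists>I. join_part G I \<and> card I = k - 1 \<and> card (verts G - I) = k \<and>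
         graph_connected (delete_verts G I))"
    (is "_ \<longleftrightarrow> ?R")
proof
  assume "G \<in> graph_class (2 * k - 1) (k - 1) k"
  then have n: "card (verts G) = 2 * k - 1" and \<alpha>: "independence_number G = k - 1"
    and con: "k_connected k G" by (auto simp: graph_class_def)
  obtain I where I: "independent_set G I" "card I = k - 1"
    using Max_in[OF finite_independent_cards[OF G]] \<alpha> by (auto simp: independence_number_def)
  have sub: "I \<subseteq> verts G" and ind: "\<And>u v. u \<in> I \<Longrightarrow> v \<in> I \<Longrightarrow> \<not> adj G u v"
    using I adj_verts(3)[OF G] unfolding independent_set_def by metis+
  have fin: "finite (verts G)" "finite I" using G sub finite_subset by (auto simp: fin_graph_def)
  have out: "card (verts G - I) = k" using card_Diff_subset[OF fin(2) sub] n I k by simp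
  have "{v. adj G u v} = verts G - I" if "u \<in> I" for u
  proof (rule card_seteq)
    show "{v. adj G u v} \<subseteq> verts G - I" using ind that adj_verts[OF G] by blast
    show "card (verts G - I) \<le> card {v. adj G u v}"
      using k_connected_card_neighbours[OF G con] that sub out by auto
  qed (use fin in simp)
  then have "join_part G I" using I by (auto simp: join_part_def)
  moreover have "graph_connected (delete_verts G I)"
    using con sub I k by (simp add: k_connected_def)
  ultimately show ?R using I out by blast
next
  assume ?R
  then obtain I where I: "join_part G I" "card I = k - 1" "card (verts G - I) = k"
    and con: "graph_connected (delete_verts G I)" by blast
  have sub: "I \<subseteq> verts G" and indI: "independent_set G I"
    and full: "\<And>u v. u \<in> I \<Longrightarrow> v \<in> verts G \<Longrightarrow> v \<notin> I \<Longrightarrow> adj G u v"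
    using I by (auto simp: join_part_def independent_set_def)
  have fin: "finite (verts G)" "finite I" using G sub finite_subset by (auto simp: fin_graph_def)
  have n: "card (verts G) = 2 * k - 1"
    using card_Diff_subset[OF fin(2) sub] I(2,3) k by linarith
  have "card S \<le> k - 1" if S: "independent_set G S" for S
  proof (cases "S \<inter> I = {}")
    case False
    then obtain a where "a \<in> S" "a \<in> I" by blast
    \<comment> \<open>The vertex \<open>a\<close> of \<open>I\<close> is adjacent to everything
      outside \<open>I\<close>, so no such vertex fits into \<open>S\<close>.\<close>
    have "S \<subseteq> I"
    proof
      fix x assume x: "x \<in> S"
      show "x \<in> I"
      proof (rule ccontr)
        assume "x \<notin> I"
        moreover have "x \<in> verts G" using S x by (auto simp: independent_set_def)
        ultimately have "adj G a x" "a \<noteq> x" using full \<open>a \<in> I\<close> by auto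
        with S x \<open>a \<in> S\<close> show False by (simp add: independent_set_def)
      qed
    qed
    then show ?thesis using I fin card_mono by metis
  next
    case True
    then have sub': "S \<subseteq> verts G - I" using S by (auto simp: independent_set_def)
    \<comment> \<open>The remainder is connected with \<open>k \<ge> 2\<close> vertices, hence
      contains an edge and is not independent. This lowers the bound from \<open>k\<close> to
      \<open>k - 1\<close>.\<close>
    have "S \<noteq> verts G - I"
    proof
      assume eq: "S = verts G - I"
      obtain a b where ab: "a \<in> S" "b \<in> S" "a \<noteq> b"
        using I k eq by (metis One_nat_def card_le_Suc0_iff_eq finite_Diff fin(1) not_less_eq_eq numeral_2_eq_2)
      then have "(adj (delete_verts G I))\<^sup>*\<^sup>* a b" using con eq by (simp add: graph_connected_def)
      then obtain c where "adj (delete_verts G I) a c" using ab by (metis converse_rtranclpE)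
      then have "adj G a c" "c \<in> S" "a \<noteq> c" using eq adj_verts[OF G, of a c] by auto
      then show False using S ab by (auto simp: independent_set_def)
    qed
    then have "card S < k" using sub' I fin psubset_card_mono[of "verts G - I" S] by auto
    then show ?thesis by simp
  qed
  then have "independence_number G = k - 1"
    unfolding independence_number_def
  proof (intro Max_eqI)
    show "k - 1 \<in> {card S |S. independent_set G S}" using I(2) indI by force
  qed (use finite_independent_cards[OF G] in auto)
  moreover have "k_connected k G"
    unfolding k_connected_def
  proof (intro conjI allI impI)
    show "k < card (verts G)" using n k by linarith
  next
    fix S assume S: "S \<subseteq> verts G \<and> card S < k"
    show "graph_connected (delete_verts G S)"
    proof (cases "I \<subseteq> S")
      case True
      have "finite S" using S fin finite_subset by blast
      \<comment> \<open>\<open>S\<close> contains the \<open>k - 1\<close> vertices of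
        \<open>I\<close> and has fewer than \<open>k\<close> elements.\<close>
      then have "I = S" using True S I by (intro card_seteq) auto
      with con show ?thesis by simp
    next
      case False
      then obtain a where a: "a \<in> I" "a \<notin> S" by blast
      \<comment> \<open>The \<open>k\<close> vertices outside \<open>I\<close> are too many for
        \<open>S\<close>. So both sides of the join survive: \<open>a\<close> sees every surviving
        vertex outside \<open>I\<close> directly and reaches those in \<open>I\<close> through
        \<open>b\<close>.\<close>
      have "\<not> verts G - I \<subseteq> S"
        using S I(3) card_mono[of S "verts G - I"] finite_subset[OF _ fin(1)] by force
      then obtain b where b: "b \<in> verts G" "b \<notin> I" "b \<notin> S" by blast
      let ?H = "delete_verts G S"
      have "(adj ?H)\<^sup>*\<^sup>* a x" if x: "x \<in> verts ?H" for x
      proof (cases "x \<in> I")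
        case True
        then have "adj ?H a b" "adj ?H x b" using full a b x by auto
        then have "adj ?H a b" "adj ?H b x" using adj_sym by metis+
        then show ?thesis by (meson converse_rtranclp_into_rtranclp r_into_rtranclp)
      next
        case False
        then have "adj ?H a x" using full a x by auto
        then show ?thesis by (rule r_into_rtranclp)
      qed
      moreover have "verts ?H \<noteq> {}" using b by auto
      ultimately show ?thesis by (rule graph_connectedI[rotated])
    qed
  qed
  ultimately show "G \<in> graph_class (2 * k - 1) (k - 1) k"
    using G n by (simp add: graph_class_def)
qed

section \<open>The extremal graphs\<close>

lemma graph_class_card_edges_ge:
  assumes "G \<in> graph_class (2 * k - 1) (k - 1) k" and k: "k \<ge> 2"
  shows "k\<^sup>2 - 1 \<le> card (edges G)"
proof -
  have G: "fin_graph G" using assms by (simp add: graph_class_def)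
  obtain I where I: "join_part G I" "card I = k - 1" "card (verts G - I) = k"
    "graph_connected (delete_verts G I)"
    using graph_class_iff_join_part[OF G k] assms by blast
  have "k \<le> Suc (card (edges (delete_verts G I)))"
    using connected_card_edges[OF fin_graph_delete_verts[OF G] I(4)] I by simp
  moreover have "k\<^sup>2 - 1 = (k - 1) * k + (k - 1)"
    using k by (cases k) (auto simp: power2_eq_square)
  ultimately show ?thesis using join_part_card_edges[OF G I(1)] I by simp
qed

text \<open>The crossing edges number \<open>k * (k - 1)\<close> whatever \<open>I\<close> is, so
  the total is extremal exactly when the connected remainder has \<open>k - 1\<close> edges and thus
  is a tree. The join description is then turned into an isomorphism.\<close>

lemma graph_class_extremal_iff:
  assumes G: "fin_graph G" and k: "k \<ge> 2"
  shows "G \<in> graph_class (2 * k - 1) (k - 1) k \<and> card (edges G) = k\<^sup>2 - 1 \<longleftrightarrow>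
    (\<exists>T :: nat sgraph. is_tree T \<and> card (verts T) = k \<and>
       graph_iso G (graph_join (edgeless (k - 1)) T))"
    (is "?L \<longleftrightarrow> ?R")
proof -
  have ksq: "k\<^sup>2 - 1 = (k - 1) * k + (k - 1)"
    using k by (cases k) (auto simp: power2_eq_square)
  have "?L \<longleftrightarrow> (\<exists>I. join_part G I \<and> card I = k - 1 \<and> card (verts G - I) = k \<and>
      is_tree (delete_verts G I))" (is "_ \<longleftrightarrow> ?M")
  proof -
    have "card (edges G) = k\<^sup>2 - 1 \<longleftrightarrow> Suc (card (edges (delete_verts G I))) = k"
      if "join_part G I" "card I = k - 1" "card (verts G - I) = k" for I
      using join_part_card_edges[OF G that(1)] k unfolding that ksq by auto
    then show ?thesis
      unfolding graph_class_iff_join_part[OF G k]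
        is_tree_iff_card_edges[OF fin_graph_delete_verts[OF G]] verts_delete_verts
      by metis
  qed
  also have "?M \<longleftrightarrow> ?R"
  proof
    assume ?M
    then obtain I where I: "join_part G I" "card I = k - 1" "card (verts G - I) = k"
      "is_tree (delete_verts G I)" by blast
    obtain T :: "nat sgraph" where T: "fin_graph T" "graph_iso (delete_verts G I) T"
      using ex_iso_nat[OF fin_graph_delete_verts[OF G]] by blast
    then have "is_tree T" "card (verts T) = k"
      using I graph_iso_is_tree[OF fin_graph_delete_verts[OF G]] graph_iso_card_verts[OF T(2)]
      by auto
    then show ?R using T I graph_iso_join_edgeless_iff[OF G] by blast
  next
    assume ?R
    then obtain T :: "nat sgraph" and I where "is_tree T" "card (verts T) = k"
      "join_part G I" "card I = k - 1" "graph_iso (delete_verts G I) T"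
      using graph_iso_join_edgeless_iff[OF G] by blast
    moreover from this have "card (verts G - I) = k" using graph_iso_card_verts by fastforce
    moreover have "is_tree (delete_verts G I)"
      using calculation graph_iso_is_tree[OF fin_graph_delete_verts[OF G]]
      by (metis is_tree_def)
    ultimately show ?M by blast
  qed
  finally show ?thesis .
qed

text \<open>A spanning tree of the complete graph serves as witness, so no concrete tree has to be
  checked for cycles.\<close>

lemma ex_tree_of_card:
  assumes "k \<ge> 1"
  obtains T :: "nat sgraph" where "is_tree T" "card (verts T) = k"
proof -
  let ?K = "\<lparr>verts = {..<k}, edges = {e. e \<subseteq> {..<k} \<and> card e = 2}\<rparr>"
  have K: "fin_graph ?K" by (simp add: fin_graph_def)
  have "(adj ?K)\<^sup>*\<^sup>* u v" if "u < k" "v < k" for u v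
  proof (cases "u = v")
    case False
    with that have "adj ?K u v" by (simp add: adj_def)
    then show ?thesis by (rule r_into_rtranclp)
  qed simp
  moreover have "verts ?K \<noteq> {}" using assms by (simp add: lessThan_empty_iff)
  ultimately have "graph_connected ?K" by (simp add: graph_connected_def)
  then obtain T where "fin_graph T" "graph_connected T" "verts T = verts ?K"
    "edges T \<subseteq> edges ?K" "Suc (card (edges T)) = card (verts ?K)"
    by (rule connected_spanning_subgraph[OF K])
  then show thesis using that[of T] is_tree_iff_card_edges[of T] by simp
qed

lemma min_edges_eq:
  assumes k: "k \<ge> 2"
  shows "min_edges (2 * k - 1) (k - 1) k = k\<^sup>2 - 1"
proof -
  obtain T :: "nat sgraph" where T: "is_tree T" "card (verts T) = k"
    using ex_tree_of_card[of k] k by auto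
  let ?J = "graph_join (edgeless (k - 1)) T"
  have "fin_graph ?J"
    using T fin_graph_join fin_graph_edgeless by (auto simp: is_tree_def)
  \<comment> \<open>The join lives on a sum type, whereas \<open>min_edges\<close> ranges over
    graphs on \<open>nat\<close>; a copy there attains the lower bound.\<close>
  then obtain G :: "nat sgraph" where G: "fin_graph G" "graph_iso ?J G"
    by (rule ex_iso_nat)
  then have "G \<in> graph_class (2 * k - 1) (k - 1) k \<and> card (edges G) = k\<^sup>2 - 1"
    using graph_class_extremal_iff[OF G(1) k] T graph_iso_sym by blast
  then have "k\<^sup>2 - 1 \<in> {card (edges G) |G :: nat sgraph. G \<in> graph_class (2 * k - 1) (k - 1) k}"
    by force
  then show ?thesis
    unfolding min_edges_def
    by (rule cInf_eq_minimum) (use graph_class_card_edges_ge k in auto)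
qed

theorem corollary3p3:
  shows "(\<forall>k::nat. k \<ge> 4 \<longrightarrow>
            min_edges (2 * k - 1) (k - 1) k = k\<^sup>2 - 1 \<and>
            (\<forall>G :: 'a sgraph. fin_graph G \<longrightarrow>
               (G \<in> graph_class (2 * k - 1) (k - 1) k \<and>
                card (edges G) = min_edges (2 * k - 1) (k - 1) k
                \<longleftrightarrow>
                (\<exists>T :: nat sgraph. is_tree T \<and> card (verts T) = k \<and>
                   graph_iso G (graph_join (edgeless (k - 1)) T)))))
         \<and> \<not> bougard_joret_conjecture"
proof (intro conjI allI impI)
  fix k :: nat assume "k \<ge> 4"
  then have k: "k \<ge> 2" by simp
  show "min_edges (2 * k - 1) (k - 1) k = k\<^sup>2 - 1" using k by (rule min_edges_eq)
  fix G :: "'a sgraph" assume "fin_graph G"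
  then show "G \<in> graph_class (2 * k - 1) (k - 1) k \<and>
      card (edges G) = min_edges (2 * k - 1) (k - 1) k \<longleftrightarrow>
      (\<exists>T :: nat sgraph. is_tree T \<and> card (verts T) = k \<and>
         graph_iso G (graph_join (edgeless (k - 1)) T))"
    unfolding min_edges_eq[OF k] using k by (rule graph_class_extremal_iff)
next
  show "\<not> bougard_joret_conjecture"
  proof
    assume "bougard_joret_conjecture"
    \<comment> \<open>The case \<open>k = 4\<close> of the family meets all constraints, with
      equality in \<open>n \<ge> \<alpha> + k\<close>; as 7 is at most 12, the first branch of the
      formula applies.\<close>
    then have "int (min_edges 7 3 4) = \<lceil>real (7 * 4) / 2\<rceil>"
      unfolding bougard_joret_conjecture_def by (elim allE[of _ 7] allE[of _ 3] allE[of _ 4]) simp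
    then show False using min_edges_eq[of 4] by simp
  qed
qed

end
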